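(* Let $p$ be an odd prime and let $N_{p-2}$ be the number of permutations of $p-2$ letters with an even number of ascents. Then $$\sum_{k=1}^{p-1}\frac{(-1)^k}{k}\equiv 2\bigl(1-2N_{p-2}\bigr)\pmod p.$$
   Context: Congruences between rationals with denominators prime to $p$ are taken in $\mathbb{Z}_{(p)}$ (or $\mathbb{Z}_p$). For a permutation $(i_1,\dots,i_n)$ of $\{1,\dots,n\}$ (mapping $j$ to $i_j$), an ascent is an index $k$ with $i_{k+1}>i_k$. *)

theory Defs
  imports Complex_Main "HOL-Computational_Algebra.Primes" "HOL-Combinatorics.Permutations"
begin

text \<open>The ring of rationals with denominator prime to \<open>p\<close>; \<open>quotient_of\<close>
  returns the numerator and denominator in lowest terms.\<close>

definition localized_ints :: "nat \<Rightarrow> rat set" where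
  "localized_ints p = {x. coprime (snd (quotient_of x)) (int p)}"

text \<open>Congruence modulo the ideal generated by \<open>p\<close> in \<^term>\<open>localized_ints p\<close>. Both sides are
  required to lie in that ring.\<close>

definition rat_cong :: "nat \<Rightarrow> rat \<Rightarrow> rat \<Rightarrow> bool" where
  "rat_cong p x y \<longleftrightarrow>
     x \<in> localized_ints p \<and> y \<in> localized_ints p \<and>
     (\<exists>z \<in> localized_ints p. x - y = of_nat p * z)"

definition ascents :: "nat \<Rightarrow> (nat \<Rightarrow> nat) \<Rightarrow> nat set" where
  "ascents n \<sigma> = {k \<in> {1..<n}. \<sigma> (Suc k) > \<sigma> k}"

definition num_even_ascent_perms :: "nat \<Rightarrow> nat" where
  "num_even_ascent_perms n = card {\<sigma>. \<sigma> permutes {1..n} \<and> even (card (ascents n \<sigma>))}"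

end

theory Submission
  imports Defs "HOL-Combinatorics.Multiset_Permutations" "HOL-Number_Theory.Residues"
begin

text \<open>
  Write \<open>asc\<close> for the number of ascents. Inserting a new maximum into all possible places of a
  permutation yields, by induction on \<open>n\<close>, Worpitzky's identity
  \<open>x ^ n = (\<Sum>\<pi>. (x + asc \<pi>) choose n)\<close>. Take \<open>n = p - 2\<close> and form the alternating sum
  over \<open>1 \<le> x \<le> p - 1\<close>. Modulo \<open>p\<close> the left-hand side becomes \<open>\<Sum>x. (-1) ^ x / x\<close> by Fermat's
  theorem. On the right-hand side \<open>y choose (p - 2)\<close> is \<open>1\<close> for \<open>y = p - 2\<close>, is \<open>-1\<close> for
  \<open>y = p - 1\<close>, and vanishes for all other \<open>y \<le> 2 * p - 3\<close>, so that each permutation contributes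
  \<open>-2 * (-1) ^ asc \<pi>\<close>. Finally \<open>\<Sum>\<pi>. (-1) ^ asc \<pi>\<close> equals \<open>2 * N - (p - 2)!\<close>, and
  \<open>(p - 2)! = 1\<close> modulo \<open>p\<close> by Wilson's theorem.
\<close>

subsection \<open>Ascents of lists\<close>

text \<open>Permutations are handled as words, since inserting a new maximum is a list operation and
  the recursion follows the first adjacent pair.\<close>

fun list_asc :: "'a::linorder list \<Rightarrow> nat" where
  "list_asc (x # y # zs) = of_bool (x < y) + list_asc (y # zs)"
| "list_asc _ = 0"

lemma list_asc_less_length: "xs \<noteq> [] \<Longrightarrow> list_asc xs < length xs"
  by (induction xs rule: list_asc.induct) (auto simp: of_bool_def)

lemma list_asc_Cons_max:
  assumes "\<forall>x\<in>set xs. x < m"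
  shows "list_asc (m # xs) = list_asc xs"
  using assms by (cases xs) auto

text \<open>The lower end \<open>m\<close> is kept general so that the induction can peel off the
  first entry. The bound \<open>n - 1\<close> appears because the last entry has no
  successor.\<close>

lemma list_asc_map_upt:
  "list_asc (map f [m..<n]) = card {k \<in> {m..<n - 1}. f k < f (Suc k)}"
proof (induction "n - m" arbitrary: m)
  case 0
  then show ?case by simp
next
  case (Suc d)
  show ?case
  proof (cases "Suc m < n")
    case False
    then have "n = Suc m" using Suc by simp
    then show ?thesis by simp
  next
    case True
    have IH: "list_asc (map f [Suc m..<n]) = card {k \<in> {Suc m..<n - 1}. f k < f (Suc k)}"
      using Suc by simp
    have "[m..<n] = m # Suc m # [Suc (Suc m)..<n]" "[Suc m..<n] = Suc m # [Suc (Suc m)..<n]"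
      using True by (simp_all add: upt_conv_Cons)
    then have "list_asc (map f [m..<n]) =
        of_bool (f m < f (Suc m)) + card {k \<in> {Suc m..<n - 1}. f k < f (Suc k)}"
      using IH by simp
    also have "{k \<in> {m..<n - 1}. f k < f (Suc k)} =
        (if f m < f (Suc m) then insert m else id) {k \<in> {Suc m..<n - 1}. f k < f (Suc k)}"
      using True by (auto simp: Suc_le_eq order_le_less)
    then have "of_bool (f m < f (Suc m)) + card {k \<in> {Suc m..<n - 1}. f k < f (Suc k)} =
        card {k \<in> {m..<n - 1}. f k < f (Suc k)}"
      by simp
    finally show ?thesis .
  qed
qed

lemma list_asc_map_upt_eq_ascents: "list_asc (map \<sigma> [1..<Suc n]) = card (ascents n \<sigma>)"
  unfolding ascents_def list_asc_map_upt by simp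

lemma bij_betw_permutes_permutations_of_set:
  "bij_betw (\<lambda>\<sigma>. map \<sigma> [1..<Suc n]) {\<sigma>. \<sigma> permutes {1..n}} (permutations_of_set {1..n})"
proof -
  let ?f = "\<lambda>\<sigma>. map \<sigma> [1..<Suc n]"
  have inj: "inj_on ?f {\<sigma>. \<sigma> permutes {1..n}}"
  proof (rule inj_onI)
    fix \<sigma> \<tau> assume perms: "\<sigma> \<in> {\<sigma>. \<sigma> permutes {1..n}}" "\<tau> \<in> {\<sigma>. \<sigma> permutes {1..n}}"
      and "?f \<sigma> = ?f \<tau>"
    then have "\<sigma> k = \<tau> k" if "k \<in> {1..n}" for k
      using that by (auto simp del: upt_Suc)
    moreover have "\<sigma> k = \<tau> k" if "k \<notin> {1..n}" for k
      using that perms by (metis mem_Collect_eq permutes_not_in)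
    ultimately show "\<sigma> = \<tau>" by blast
  qed
  have sub: "?f ` {\<sigma>. \<sigma> permutes {1..n}} \<subseteq> permutations_of_set {1..n}"
  proof safe
    fix \<sigma> assume "\<sigma> permutes {1..n}"
    then show "?f \<sigma> \<in> permutations_of_set {1..n}"
      by (auto simp: permutations_of_set_def distinct_map permutes_image
          atLeastLessThanSuc_atLeastAtMost permutes_inj_on simp del: upt_Suc)
  qed
  \<comment> \<open>Surjectivity by counting: the image is a subset, and both sets have
    \<open>fact n\<close> elements.\<close>
  have "?f ` {\<sigma>. \<sigma> permutes {1..n}} = permutations_of_set {1..n}"
    using sub by (rule card_subset_eq[rotated])
      (simp_all add: card_image[OF inj] card_permutations[OF refl] del: upt_Suc One_nat_def)
  with inj show ?thesis by (simp add: bij_betw_def)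
qed

subsection \<open>Insertion of a new maximum\<close>

definition insert_nth :: "nat \<Rightarrow> 'a \<Rightarrow> 'a list \<Rightarrow> 'a list" where
  "insert_nth i m xs = take i xs @ m # drop i xs"

lemma insert_nth_0 [simp]: "insert_nth 0 m xs = m # xs"
  and insert_nth_Suc [simp]: "insert_nth (Suc i) m (x # xs) = x # insert_nth i m xs"
  by (simp_all add: insert_nth_def)

text \<open>The Eulerian recurrence in weighted form. A maximum placed in front or inside an ascent
  leaves the count unchanged (\<open>list_asc xs + 1\<close> places); at every other place it
  creates exactly one new ascent. The weight \<open>g\<close> is arbitrary so that the induction can
  shift it.\<close>

lemma sum_list_asc_insert_nth:
  fixes g :: "nat \<Rightarrow> 'a::comm_ring_1"
  assumes "\<forall>x\<in>set xs. x < m"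
  shows "(\<Sum>i\<le>length xs. g (list_asc (insert_nth i m xs))) =
      (of_nat (list_asc xs) + 1) * g (list_asc xs) +
      (of_nat (length xs) - of_nat (list_asc xs)) * g (list_asc xs + 1)"
  using assms
proof (induction xs arbitrary: g rule: list_asc.induct)
  case (1 x y zs)
  define a where "a = list_asc (y # zs)"
  define l where "l = length (y # zs)"
  define c :: nat where "c = of_bool (x < y)"
  have max: "list_asc (m # y # zs) = a"
    unfolding a_def by (rule list_asc_Cons_max) (use "1.prems" in auto)
  \<comment> \<open>If \<open>m\<close> goes in after \<open>y\<close>, the pair \<open>x\<close>,
    \<open>y\<close> stays adjacent and contributes \<open>c\<close>; hence the induction hypothesis
    for \<open>g\<close> shifted by \<open>c\<close>. Insertions before \<open>x\<close> and between
    \<open>x\<close> and \<open>y\<close> are computed by hand.\<close>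
  have "(\<Sum>i\<le>l. g (c + list_asc (insert_nth i m (y # zs)))) =
      (of_nat a + 1) * g (c + a) + (of_nat l - of_nat a) * g (c + (a + 1))"
    using "1.IH"[of "\<lambda>k. g (c + k)"] "1.prems" unfolding a_def l_def by simp
  then have IH: "g (c + a) + (\<Sum>i<length (y # zs). g (c + list_asc (y # insert_nth i m zs))) =
      (of_nat a + 1) * g (c + a) + (of_nat l - of_nat a) * g (c + (a + 1))"
    using max by (simp add: l_def sum.atMost_shift del: list_asc.simps sum.atMost_Suc sum.lessThan_Suc)
  have hd: "list_asc (x # y # zs) = c + a"
    by (simp add: c_def a_def)
  have "list_asc (m # x # y # zs) = c + a"
    using list_asc_Cons_max[OF "1.prems"] hd by simp
  moreover have "list_asc (x # m # y # zs) = 1 + a"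
    using max "1.prems" by simp
  moreover have "list_asc (x # y # insert_nth i m zs) = c + list_asc (y # insert_nth i m zs)" for i
    by (simp add: c_def)
  ultimately have "(\<Sum>i\<le>length (x # y # zs). g (list_asc (insert_nth i m (x # y # zs)))) =
      g (c + a) + (g (1 + a) + (\<Sum>i<length (y # zs). g (c + list_asc (y # insert_nth i m zs))))"
    by (simp add: sum.atMost_shift sum.lessThan_Suc_shift del: list_asc.simps sum.atMost_Suc sum.lessThan_Suc)
  also have "\<dots> = g (1 + a) + (of_nat a + 1) * g (c + a) + (of_nat l - of_nat a) * g (c + (a + 1))"
    using IH by (simp add: algebra_simps)
  \<comment> \<open>The extra term \<open>g (1 + a)\<close> joins the first summand if
    \<open>x < y\<close> and the second one otherwise.\<close>
  also have "\<dots> = (of_nat (c + a) + 1) * g (c + a) + (of_nat (Suc l) - of_nat (c + a)) * g (c + a + 1)"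
    by (cases "x < y") (simp_all add: c_def algebra_simps)
  finally show ?case
    using hd by (simp add: l_def)
qed (auto simp: sum.atMost_Suc)

lemma insert_nth_inj:
  assumes "m \<notin> set xs" "m \<notin> set ys" "i \<le> length xs" "j \<le> length ys"
    and "insert_nth i m xs = insert_nth j m ys"
  shows "xs = ys \<and> i = j"
proof -
  have "m \<notin> set (take i xs)" "m \<notin> set (take j ys)" "m \<notin> set (drop i xs)" "m \<notin> set (drop j ys)"
    using assms by (meson in_set_takeD in_set_dropD)+
  then have eq: "take i xs = take j ys \<and> drop i xs = drop j ys"
    using assms(5) unfolding insert_nth_def by (metis append_Cons_eq_iff)
  then have "xs = ys" by (metis append_take_drop_id)
  moreover have "i = j" using eq assms(3,4) by (metis length_take min.absorb2)
  ultimately show ?thesis by simp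
qed

text \<open>The inverse deletes \<open>m\<close> and records the position where it stood.\<close>

lemma bij_betw_insert_nth:
  assumes "finite A" "m \<notin> A"
  shows "bij_betw (\<lambda>(xs, i). insert_nth i m xs)
      (permutations_of_set A \<times> {..card A}) (permutations_of_set (insert m A))"
proof (rule bij_betw_imageI)
  have "xs = ys \<and> i = j"
    if "xs \<in> permutations_of_set A" "ys \<in> permutations_of_set A" "i \<le> card A" "j \<le> card A"
      and "insert_nth i m xs = insert_nth j m ys" for xs i ys j
    using insert_nth_inj[of m xs ys i j] that assms(2)
    by (simp add: permutations_of_setD length_finite_permutations_of_set)
  then show "inj_on (\<lambda>(xs, i). insert_nth i m xs) (permutations_of_set A \<times> {..card A})"
    by (auto simp: inj_on_def)
  show "(\<lambda>(xs, i). insert_nth i m xs) ` (permutations_of_set A \<times> {..card A}) =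
      permutations_of_set (insert m A)"
  proof (intro equalityI subsetI)
    fix zs assume "zs \<in> (\<lambda>(xs, i). insert_nth i m xs) ` (permutations_of_set A \<times> {..card A})"
    then obtain xs i where xs: "xs \<in> permutations_of_set A" and zs: "zs = insert_nth i m xs"
      by auto
    have "mset zs = mset (m # xs)"
      unfolding zs insert_nth_def by (metis append_take_drop_id mset_append mset.simps(2) union_mset_add_mset_right)
    then have "set zs = set (m # xs)" "distinct zs \<longleftrightarrow> distinct (m # xs)"
      by (rule mset_eq_setD, rule mset_eq_imp_distinct_iff)
    then show "zs \<in> permutations_of_set (insert m A)"
      using permutations_of_setD[OF xs] assms(2) by (auto simp: permutations_of_set_def)
  next
    fix zs assume zs: "zs \<in> permutations_of_set (insert m A)"
    then have "m \<in> set zs" by (simp add: permutations_of_setD)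
    then obtain us vs where split: "zs = us @ m # vs" by (meson split_list)
    have "set (us @ vs) = A" "distinct (us @ vs)"
      using permutations_of_setD[OF zs] assms(2) unfolding split by auto
    then have "us @ vs \<in> permutations_of_set A" by (simp add: permutations_of_set_def)
    moreover have "length us \<le> card A"
      using length_finite_permutations_of_set[OF calculation] by simp
    moreover have "zs = insert_nth (length us) m (us @ vs)"
      by (simp add: insert_nth_def split)
    ultimately show "zs \<in> (\<lambda>(xs, i). insert_nth i m xs) ` (permutations_of_set A \<times> {..card A})"
      by force
  qed
qed

subsection \<open>Worpitzky's identity\<close>

text \<open>The weights are those of \<open>sum_list_asc_insert_nth\<close>. Pascal's rule turns the
  right-hand side into \<open>(n + 1) * ((x + a) choose Suc n) + (n - a) * ((x + a) choose
  n)\<close>, and absorption replaces the first term by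
  \<open>(x + a - n) * ((x + a) choose n)\<close>. If \<open>x + a < n\<close>, all the binomials
  vanish.\<close>

lemma mult_binomial_eq:
  assumes "a \<le> n"
  shows "int x * int ((x + a) choose n) =
      (int a + 1) * int ((x + a) choose Suc n) + (int n - int a) * int (Suc (x + a) choose Suc n)"
proof (cases "n \<le> x + a")
  case True
  have "Suc n * ((x + a) choose Suc n) = (x + a - n) * ((x + a) choose n)"
    using binomial_absorb_comp[of "x + a" n] binomial_absorption[of n "x + a"] by simp
  then have "(int n + 1) * int ((x + a) choose Suc n) =
      (int x + int a - int n) * int ((x + a) choose n)"
    using True by (metis of_nat_mult of_nat_diff of_nat_add of_nat_Suc add.commute)
  then show ?thesis by (simp add: algebra_simps)
qed (simp add: binomial_eq_0)

theorem worpitzky: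
  "(\<Sum>xs\<in>permutations_of_set {1..n}. int ((x + list_asc xs) choose n)) = int x ^ n"
proof (induction n)
  case 0
  then show ?case by simp
next
  case (Suc n)
  let ?P = "permutations_of_set {1..n}"
  have "(\<Sum>xs\<in>permutations_of_set {1..Suc n}. int ((x + list_asc xs) choose Suc n)) =
      (\<Sum>(xs, i)\<in>?P \<times> {..n}. int ((x + list_asc (insert_nth i (Suc n) xs)) choose Suc n))"
    using sum.reindex_bij_betw[OF bij_betw_insert_nth[of "{1..n}" "Suc n"],
        of "\<lambda>xs. int ((x + list_asc xs) choose Suc n)"]
    by (simp add: case_prod_unfold atLeastAtMostSuc_conv del: binomial_Suc_Suc)
  also have "\<dots> = (\<Sum>xs\<in>?P. \<Sum>i\<le>n. int ((x + list_asc (insert_nth i (Suc n) xs)) choose Suc n))"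
    by (simp add: sum.cartesian_product)
  also have "\<dots> = (\<Sum>xs\<in>?P. int x * int ((x + list_asc xs) choose n))"
  proof (rule sum.cong[OF refl])
    fix xs assume xs: "xs \<in> ?P"
    then have len: "length xs = n"
      by (simp add: length_finite_permutations_of_set)
    moreover have "list_asc xs \<le> n"
      using list_asc_less_length[of xs] len by (cases xs) auto
    moreover have "\<forall>y\<in>set xs. y < Suc n"
      using permutations_of_setD[OF xs] by auto
    ultimately show "(\<Sum>i\<le>n. int ((x + list_asc (insert_nth i (Suc n) xs)) choose Suc n)) =
        int x * int ((x + list_asc xs) choose n)"
      using sum_list_asc_insert_nth[of xs "Suc n" "\<lambda>a. int ((x + a) choose Suc n)"]
        mult_binomial_eq[of "list_asc xs" n x] by (simp del: binomial_Suc_Suc)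
  qed
  also have "\<dots> = int x ^ Suc n"
    by (simp add: Suc flip: sum_distrib_left del: One_nat_def)
  finally show ?case .
qed

subsection \<open>The alternating sum modulo \<open>p\<close>\<close>

text \<open>Both \<open>k\<close> and \<open>y - k\<close> are below \<open>p\<close>, so
  \<open>p\<close> divides \<open>fact y\<close> but neither factorial in the denominator.\<close>

lemma prime_dvd_binomial:
  fixes p :: nat
  assumes "prime p" "p \<le> y" "k < p" "y < p + k"
  shows "p dvd (y choose k)"
proof -
  have "fact k * fact (y - k) * (y choose k) = (fact y :: nat)"
    using assms by (intro binomial_fact_lemma) auto
  then have "p dvd fact k * fact (y - k) * (y choose k)"
    using assms by (simp add: prime_dvd_fact_iff)
  moreover have "\<not> p dvd fact k" "\<not> p dvd fact (y - k)"
    using assms by (auto simp: prime_dvd_fact_iff)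
  ultimately show ?thesis
    using assms(1) by (simp add: prime_dvd_mult_iff)
qed

text \<open>The bound on \<open>a\<close> puts both \<open>p - 2 - a\<close> and
  \<open>p - 1 - a\<close> into the range of summation and keeps \<open>x + a\<close> below
  \<open>p + (p - 2)\<close>, so \<open>prime_dvd_binomial\<close> covers every
  \<open>x + a \<ge> p\<close>.\<close>

lemma alternating_sum_binomial_cong:
  assumes "prime p" "odd p" "a < p - 2"
  shows "[(\<Sum>x=1..p-1. (-1) ^ x * int ((x + a) choose (p - 2))) = - 2 * (-1) ^ a] (mod int p)"
proof -
  have p: "p \<ge> 3" using assms(3) by simp
  let ?f = "\<lambda>x. (-1) ^ x * int ((x + a) choose (p - 2))"
  have "[(\<Sum>x=1..p-1. ?f x) =
      (\<Sum>x=1..p-1. (if x = p - 2 - a then - ((-1) ^ a) else 0) + (if x = p - 1 - a then - ((-1) ^ a) else 0))]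
      (mod int p)"
  proof (rule cong_sum)
    fix x assume x: "x \<in> {1..p-1}"
    consider "x + a < p - 2" | "x = p - 2 - a" | "x = p - 1 - a" | "p \<le> x + a"
      using x by force
    then show "[?f x = (if x = p - 2 - a then - ((-1) ^ a) else 0) +
        (if x = p - 1 - a then - ((-1) ^ a) else 0)] (mod int p)"
    proof cases
      case 1
      then show ?thesis by (auto simp: binomial_eq_0)
    next
      \<comment> \<open>Here the minus sign comes from parity, as \<open>p - 2\<close> is odd; in
        the next case the parities agree and it comes from the binomial, \<open>p - 1\<close>, which
        is \<open>-1\<close> modulo \<open>p\<close>.\<close>
      case 2
      then have *: "x + a = p - 2" using assms(3) by simp
      then have "odd (x + a)" using assms(2) p by simp
      then have "(-1) ^ x = - ((-1) ^ a :: int)" by (cases "even a") auto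
      then show ?thesis using 2 * assms(3) by auto
    next
      case 3
      then have *: "x + a = p - 1" using assms(3) by simp
      then have "even (x + a)" using assms(2) p by simp
      then have sgn: "(-1) ^ x = ((-1) ^ a :: int)" by (cases "even a") auto
      have "(p - 1) choose (p - 2) = p - 1"
        using binomial_symmetric[of "p - 2" "p - 1"] p by simp
      then have "?f x = (-1) ^ a * (int p - 1)" using sgn * p by (simp add: of_nat_diff)
      moreover have "[(-1) ^ a * (int p - 1) = - ((-1) ^ a)] (mod int p)"
        by (simp add: cong_iff_dvd_diff algebra_simps)
      ultimately show ?thesis using 3 assms(3) by auto
    next
      case 4
      have "p dvd ((x + a) choose (p - 2))"
        using 4 x assms by (intro prime_dvd_binomial) auto
      then show ?thesis
        using 4 assms(3) by (auto simp: cong_0_iff)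
    qed
  qed
  also have "(\<Sum>x=1..p-1. (if x = p - 2 - a then - ((-1) ^ a) else 0) +
      (if x = p - 1 - a then - ((-1) ^ a) else 0)) = (- 2 * (-1) ^ a :: int)"
    using assms(3) by (auto simp: sum.distrib)
  finally show ?thesis .
qed

lemma sum_sign_list_asc:
  "(\<Sum>xs\<in>permutations_of_set {1..n}. (-1) ^ list_asc xs) =
    2 * int (num_even_ascent_perms n) - fact n"
proof -
  let ?S = "{\<sigma>. \<sigma> permutes {1..n}}"
  have fin: "finite ?S" by (simp add: finite_permutations)
  have "(\<Sum>xs\<in>permutations_of_set {1..n}. (-1) ^ list_asc xs) =
      (\<Sum>\<sigma>\<in>?S. (-1) ^ card (ascents n \<sigma>) :: int)"
    using sum.reindex_bij_betw[OF bij_betw_permutes_permutations_of_set,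
        of "\<lambda>xs. (-1) ^ list_asc xs :: int" n]
    by (simp add: list_asc_map_upt_eq_ascents del: upt_Suc One_nat_def)
  \<comment> \<open>A sign is twice the indicator of evenness minus one.\<close>
  also have "\<dots> = (\<Sum>\<sigma>\<in>?S. 2 * of_bool (even (card (ascents n \<sigma>))) - 1)"
    by (intro sum.cong) auto
  also have "\<dots> = 2 * int (card {\<sigma>\<in>?S. even (card (ascents n \<sigma>))}) - int (card ?S)"
    using fin by (simp add: sum_subtractf flip: sum_distrib_left)
       (simp add: of_bool_def sum.If_cases Int_def)
  also have "card ?S = fact n"
    by (simp add: card_permutations[OF refl])
  finally show ?thesis
    by (simp add: num_even_ascent_perms_def)
qed

text \<open>Wilson's theorem with the factor \<open>p - 1\<close>, which is \<open>-1\<close> modulo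
  \<open>p\<close>, removed from \<open>fact (p - 1)\<close>.\<close>

lemma fact_prime_minus_2_cong:
  assumes "prime p"
  shows "[fact (p - 2) = (1 :: int)] (mod int p)"
proof -
  have p: "p \<ge> 2" using assms by (simp add: prime_ge_2_nat)
  have "(fact (p - 1) :: int) = (int p - 1) * fact (p - 2)"
    using p by (subst fact_reduce) (auto simp: of_nat_diff numeral_2_eq_2)
  then have "int p * fact (p - 2) - (fact (p - 1) + 1) = fact (p - 2) - (1 :: int)"
    by (simp add: algebra_simps)
  moreover have "int p dvd fact (p - 1) + 1"
    using wilson_theorem[OF assms] by (simp add: cong_iff_dvd_diff)
  ultimately show ?thesis
    unfolding cong_iff_dvd_diff by (metis dvd_diff dvd_triv_left)
qed

lemma alternating_sum_power_cong:
  assumes "prime p" "odd p"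
  shows "[(\<Sum>x=1..p-1. (-1) ^ x * int x ^ (p - 2)) =
      2 * (1 - 2 * int (num_even_ascent_perms (p - 2)))] (mod int p)"
proof -
  have p: "p \<ge> 3" using assms prime_ge_2_nat[of p] by (cases "p = 2") auto
  let ?P = "permutations_of_set {1..p - 2}"
  have "(\<Sum>x=1..p-1. (-1) ^ x * int x ^ (p - 2)) =
      (\<Sum>x=1..p-1. \<Sum>xs\<in>?P. (-1) ^ x * int ((x + list_asc xs) choose (p - 2)))"
    by (simp add: worpitzky flip: sum_distrib_left del: One_nat_def)
  also have "\<dots> = (\<Sum>xs\<in>?P. \<Sum>x=1..p-1. (-1) ^ x * int ((x + list_asc xs) choose (p - 2)))"
    by (rule sum.swap)
  also have "[\<dots> = (\<Sum>xs\<in>?P. - 2 * (-1) ^ list_asc xs)] (mod int p)"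
  proof (intro cong_sum alternating_sum_binomial_cong assms)
    fix xs assume "xs \<in> ?P"
    then have "length xs = p - 2" by (simp add: length_finite_permutations_of_set)
    \<comment> \<open>Strictness needs \<open>xs\<close> to be nonempty, which holds because
      \<open>p \<ge> 3\<close>.\<close>
    then show "list_asc xs < p - 2"
      using list_asc_less_length[of xs] p by (cases xs) auto
  qed
  also have "(\<Sum>xs\<in>?P. - 2 * (-1) ^ list_asc xs) = - 2 * (\<Sum>xs\<in>?P. (-1) ^ list_asc xs :: int)"
    by (rule sum_distrib_left[symmetric])
  also have "\<dots> = 2 * (fact (p - 2) - 2 * int (num_even_ascent_perms (p - 2)))"
    unfolding sum_sign_list_asc by (simp add: algebra_simps)
  also have "[\<dots> = 2 * (1 - 2 * int (num_even_ascent_perms (p - 2)))] (mod int p)"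
    by (intro cong_mult cong_diff cong_refl fact_prime_minus_2_cong assms)
  finally show ?thesis .
qed

subsection \<open>Localized integers\<close>

text \<open>Membership is defined through lowest terms; the reduced denominator divides any other
  denominator \<open>b\<close> and so inherits coprimality to \<open>p\<close>.\<close>

lemma localized_ints_divide:
  assumes "coprime b (int p)" "b \<noteq> 0"
  shows "of_int a / of_int b \<in> localized_ints p"
proof -
  obtain c d where cd: "quotient_of (of_int a / of_int b) = (c, d)" by fastforce
  then have "d > 0" "coprime c d" and eq: "of_int a / of_int b = (of_int c / of_int d :: rat)"
    using quotient_of_denom_pos quotient_of_coprime quotient_of_div by blast+
  have "(of_int (a * d) :: rat) = of_int (c * b)"
    using eq assms(2) \<open>d > 0\<close> by (simp add: field_simps)
  then have "d dvd c * b"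
    by (metis dvd_triv_right of_int_eq_iff)
  then have "d dvd b"
    using \<open>coprime c d\<close> by (simp add: coprime_dvd_mult_right_iff coprime_commute)
  then have "coprime d (int p)"
    using assms(1) by (meson coprime_divisors dvd_refl)
  then show ?thesis by (simp add: localized_ints_def cd)
qed

lemma localized_ints_of_int: "of_int a \<in> localized_ints p"
  using localized_ints_divide[of 1 p a] by simp

lemma localized_ints_add:
  assumes "x \<in> localized_ints p" "y \<in> localized_ints p"
  shows "x + y \<in> localized_ints p"
proof -
  obtain a b c d where q: "quotient_of x = (a, b)" "quotient_of y = (c, d)" by fastforce
  then have pos: "b > 0" "d > 0" and eq: "x = of_int a / of_int b" "y = of_int c / of_int d"
    using quotient_of_denom_pos quotient_of_div by blast+
  have "x + y = of_int (a * d + c * b) / of_int (b * d)"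
    using pos by (simp add: eq field_simps)
  moreover have "coprime (b * d) (int p)"
    using assms q by (simp add: localized_ints_def)
  ultimately show ?thesis
    using localized_ints_divide[of "b * d" p "a * d + c * b"] pos by simp
qed

lemma localized_ints_sum:
  "(\<And>i. i \<in> A \<Longrightarrow> f i \<in> localized_ints p) \<Longrightarrow> sum f A \<in> localized_ints p"
  using localized_ints_of_int[of 0 p]
  by (induction A rule: infinite_finite_induct) (auto intro: localized_ints_add)

theorem theorem2:
  fixes p :: nat
  assumes "prime p" and "odd p"
  shows "rat_cong p (\<Sum>k=1..p-1. (-1) ^ k / of_nat k)
           (2 * (1 - 2 * of_nat (num_even_ascent_perms (p - 2))))"
proof -
  define Y where "Y = 2 * (1 - 2 * int (num_even_ascent_perms (p - 2)))"
  have Y: "2 * (1 - 2 * of_nat (num_even_ascent_perms (p - 2))) = (of_int Y :: rat)"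
    by (simp add: Y_def)
  have frac: "of_int a / of_nat k \<in> localized_ints p" if "k \<in> {1..p-1}" for a k
  proof -
    have "\<not> p dvd k" using that by (auto dest: dvd_imp_le)
    then have "coprime (int k) (int p)"
      using prime_imp_coprime[of p k] assms(1) by (simp add: coprime_commute)
    then show ?thesis
      using localized_ints_divide[of "int k" p a] that by simp
  qed
  have "\<exists>c. 1 - int k ^ (p - 1) = int p * c" if "k \<in> {1..p-1}" for k
  proof -
    have "\<not> p dvd k" using that by (auto dest: dvd_imp_le)
    then have "[k ^ (p - 1) = 1] (mod p)" by (rule fermat_theorem[OF assms(1)])
    then have "[1 = int k ^ (p - 1)] (mod int p)"
      by (metis cong_int_iff cong_sym of_nat_1 of_nat_power)
    then show ?thesis by (auto simp: cong_iff_dvd_diff)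
  qed
  then obtain c where c: "\<And>k. k \<in> {1..p-1} \<Longrightarrow> 1 - int k ^ (p - 1) = int p * c k"
    by metis
  obtain d where d: "(\<Sum>k=1..p-1. (-1) ^ k * int k ^ (p - 2)) - Y = int p * d"
    using alternating_sum_power_cong[OF assms] by (auto simp: Y_def cong_iff_dvd_diff)
  \<comment> \<open>Dividing \<open>1 - k ^ (p - 1) = p * c k\<close> by \<open>k\<close> gives
    \<open>1 / k = k ^ (p - 2) + p * (c k / k)\<close>. The witness \<open>z\<close> collects these
    error terms and the quotient \<open>d\<close> of the integer congruence.\<close>
  define z :: rat where "z = of_int d + (\<Sum>k=1..p-1. of_int ((-1) ^ k * c k) / of_nat k)"
  have "(-1) ^ k / of_nat k =
      of_int ((-1) ^ k * int k ^ (p - 2)) + of_nat p * (of_int ((-1) ^ k * c k) / of_nat k :: rat)"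
    if k: "k \<in> {1..p-1}" for k
  proof -
    have "p - 1 = Suc (p - 2)" using k by auto
    then have "int k * int k ^ (p - 2) + int p * c k = 1"
      using c[OF k] by simp
    then have "of_nat k * of_nat k ^ (p - 2) + of_nat p * of_int (c k) = (1 :: rat)"
      by (metis of_int_1 of_int_add of_int_mult of_int_of_nat_eq of_int_power)
    then have "(-1) ^ k * (of_nat k * of_nat k ^ (p - 2) + of_nat p * of_int (c k)) = ((-1) ^ k :: rat)"
      by simp
    then show ?thesis using k by (simp add: field_simps)
  qed
  then have "(\<Sum>k=1..p-1. (-1) ^ k / of_nat k) =
      of_int (\<Sum>k=1..p-1. (-1) ^ k * int k ^ (p - 2)) +
      of_nat p * (\<Sum>k=1..p-1. of_int ((-1) ^ k * c k) / of_nat k :: rat)"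
    by (simp add: sum.distrib sum_distrib_left)
  moreover have "(\<Sum>k=1..p-1. (-1) ^ k * int k ^ (p - 2)) = Y + int p * d"
    using d by simp
  ultimately have diff: "(\<Sum>k=1..p-1. (-1) ^ k / of_nat k) - of_int Y = of_nat p * z"
    by (simp only: z_def of_int_add of_int_mult of_int_of_nat_eq) (simp add: algebra_simps)
  have "z \<in> localized_ints p"
    unfolding z_def by (intro localized_ints_add localized_ints_sum localized_ints_of_int frac)
  moreover have "(\<Sum>k=1..p-1. (-1) ^ k / of_nat k) \<in> localized_ints p"
    using frac[of _ "(-1) ^ _"] by (intro localized_ints_sum) simp
  ultimately show ?thesis
    unfolding rat_cong_def Y using diff localized_ints_of_int by blast
qed

end
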